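(* Let $\bar{\mathbb R}=\mathrm{Hom}[\mathbb R,T]$ be the Bohr compactification of the line and $\mu_0$ its normalized Haar measure. Then $\mu_0$ is supported on the set $W$ of all elements $\bar x\in\bar{\mathbb R}$ which are everywhere discontinuous as maps $\bar x:\mathbb R\to T$; that is, the complement of $W$, $$W^{\rm c}=\{\bar x\in\bar{\mathbb R} : \exists\, s_0\in\mathbb R \text{ such that } \bar x \text{ is continuous at } s_0\},$$ is contained in a measurable set of $\mu_0$-measure zero.
   Context: $T$ is the multiplicative group of complex numbers of modulus one, with its usual topology. $\bar{\mathbb R}=\mathrm{Hom}[\mathbb R,T]$ is the set of all (not necessarily continuous) group morphisms from $(\mathbb R,+)$ to $T$, with pointwise multiplication $(\bar x\,\bar x')(k)=\bar x(k)\bar x'(k)$ and the topology induced from the Tychonoff product topology on $\prod_{k\in\mathbb R}T$ (pointwise convergence). It is a compact Hausdorff commutative group, and $\mu_0$ is its normalized Haar measure. Continuity of $\bar x$ as a map $\mathbb R\to T$ refers to the usual topologies of $\mathbb R$ and $T$. *)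

theory Defs
  imports "HOL-Analysis.Analysis" "HOL-Algebra.Group"
begin

definition real_add_group :: "real monoid" where
  "real_add_group = \<lparr>carrier = UNIV, mult = (+), one = 0\<rparr>"

definition circle_group :: "complex monoid" where
  "circle_group = \<lparr>carrier = sphere 0 1, mult = (*), one = 1\<rparr>"

text \<open>The Bohr compactification of the line: its elements are arbitrary, not necessarily
  continuous, characters. Their domain is a whole type, so no extensionality condition is needed.\<close>

definition bohr_group :: "(real \<Rightarrow> complex) monoid" where
  "bohr_group = \<lparr>carrier = hom real_add_group circle_group,
     mult = (\<lambda>x y k. x k \<otimes>\<^bsub>circle_group\<^esub> y k), one = (\<lambda>k. \<one>\<^bsub>circle_group\<^esub>)\<rparr>"

definition bohr_topology :: "(real \<Rightarrow> complex) topology" where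
  "bohr_topology =
     subtopology (product_topology (\<lambda>k. top_of_set (carrier circle_group)) UNIV)
       (carrier bohr_group)"

lemma carrier_bohr_group:
  "carrier bohr_group = {x. (\<forall>k. cmod (x k) = 1) \<and> (\<forall>k l. x (k + l) = x k * x l)}"
  by (auto simp: bohr_group_def hom_def real_add_group_def circle_group_def)

lemma topspace_bohr_topology: "topspace bohr_topology = carrier bohr_group"
  by (auto simp: bohr_topology_def carrier_bohr_group circle_group_def)

lemma comm_group_bohr_group: "comm_group bohr_group"
proof (rule comm_groupI)
  fix x assume x: "x \<in> carrier bohr_group"
  then have n: "cmod (x k) = 1" for k by (simp add: carrier_bohr_group)
  then have nz: "x k \<noteq> 0" for k by (metis norm_zero zero_neq_one)
  have "(\<lambda>k. inverse (x k)) \<in> carrier bohr_group"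
    using x by (simp add: carrier_bohr_group norm_inverse)
  moreover have "(\<lambda>k. inverse (x k)) \<otimes>\<^bsub>bohr_group\<^esub> x = \<one>\<^bsub>bohr_group\<^esub>"
    using nz by (simp add: bohr_group_def circle_group_def)
  ultimately show "\<exists>y\<in>carrier bohr_group. y \<otimes>\<^bsub>bohr_group\<^esub> x = \<one>\<^bsub>bohr_group\<^esub>" by blast
qed (auto simp: carrier_bohr_group norm_mult, auto simp: bohr_group_def circle_group_def norm_mult mult_ac)

lemma Hausdorff_space_bohr_topology: "Hausdorff_space bohr_topology"
  unfolding bohr_topology_def
  by (intro Hausdorff_space_subtopology)
     (simp add: Hausdorff_space_product_topology Hausdorff_space_subtopology)

lemma compact_space_bohr_topology: "compact_space bohr_topology"
proof -
  let ?P = "product_topology (\<lambda>k::real. top_of_set (carrier circle_group)) UNIV"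
  have P: "compact_space ?P"
    by (simp add: compact_space_product_topology compact_space_subtopology circle_group_def)
  have c: "continuous_map ?P euclidean (\<lambda>x. x k)" for k
    using continuous_map_product_projection[of k UNIV "\<lambda>k. top_of_set (carrier circle_group)"]
    by (simp add: continuous_map_in_subtopology)
  have "closedin ?P {x \<in> topspace ?P. x (k + l) - x k * x l \<in> {0}}" for k l
  proof (rule closedin_continuous_map_preimage[of _ euclidean])
    have "continuous_map ?P euclidean (\<lambda>x. x k * x l)"
      using c by (simp add: continuous_map_atin tendsto_mult)
    then show "continuous_map ?P euclidean (\<lambda>x. x (k + l) - x k * x l)"
      by (intro continuous_map_diff c)
  qed simp
  then have "closedin ?P (\<Inter>k. \<Inter>l. {x \<in> topspace ?P. x (k + l) - x k * x l \<in> {0}})"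
    by (intro closedin_INT) auto
  also have "(\<Inter>k. \<Inter>l. {x \<in> topspace ?P. x (k + l) - x k * x l \<in> {0}}) = carrier bohr_group"
    by (auto simp: carrier_bohr_group circle_group_def PiE_iff)
  finally show ?thesis
    unfolding bohr_topology_def using P closedin_compact_space compact_space_subtopology by blast
qed

text \<open>Regularity has to be required: a Borel measure on a compact Hausdorff space that is not
  second countable need not be regular, and the uniqueness theorem for Haar measure is about
  regular measures. Compact sets are Borel because the topology is meant to be Hausdorff.\<close>

definition normalized_Haar_measure ::
  "('a, 'b) monoid_scheme \<Rightarrow> 'a topology \<Rightarrow> 'a measure \<Rightarrow> bool" where
  "normalized_Haar_measure G X M \<longleftrightarrow>
     space M = topspace X \<and>
     sets M = sigma_sets (topspace X) {U. openin X U} \<and>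
     emeasure M (space M) = 1 \<and>
     (\<forall>g\<in>carrier G. \<forall>A\<in>sets M. emeasure M ((\<lambda>x. g \<otimes>\<^bsub>G\<^esub> x) ` A) = emeasure M A) \<and>
     (\<forall>A\<in>sets M. emeasure M A = (INF U\<in>{U. openin X U \<and> A \<subseteq> U}. emeasure M U)) \<and>
     (\<forall>A\<in>sets M. emeasure M A = (SUP K\<in>{K. compactin X K \<and> K \<subseteq> A}. emeasure M K))"

definition everywhere_discontinuous_characters :: "(real \<Rightarrow> complex) set" where
  "everywhere_discontinuous_characters = {x \<in> carrier bohr_group. \<forall>s. \<not> isCont x s}"

end

theory Submission
  imports Defs
begin

text \<open>A character continuous at one point is continuous at 0, so for some n it lies in the closed
  set of characters that stay within 1/2 of 1 on the interval of radius 1/(n + 1). Translating this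
  set by the continuous characters \<open>t \<mapsto> exp (\<i> c t)\<close>, with \<open>c\<close> a multiple of \<open>4 (n + 1)\<close>, gives
  infinitely many disjoint sets: two of these translating characters take opposite values at some
  point of the interval. By invariance and finiteness of the measure, the set is null.\<close>

text \<open>Infinitely many disjoint sets of one positive measure would have a union of infinite
  measure. The \<open>B j\<close> need not be assumed measurable.\<close>

lemma (in finite_measure) null_sets_disjoint_family:
  assumes "disjoint_family B" and eq: "\<And>j::nat. emeasure M (B j) = emeasure M A"
    and A: "A \<in> sets M"
  shows "A \<in> null_sets M"
proof (rule ccontr)
  assume "A \<notin> null_sets M"
  then have nz: "emeasure M A \<noteq> 0"
    using A by auto
  \<comment> \<open>\<open>emeasure\<close> is 0 by default outside \<open>sets M\<close>, so a
    nonzero value forces each \<open>B j\<close> to be measurable.\<close>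
  then have "range B \<subseteq> sets M"
    using eq emeasure_notin_sets by (metis image_subsetI)
  then have "(\<lambda>j. measure M (B j)) sums measure M (\<Union>j. B j)"
    using assms(1) by (rule finite_measure_UNION)
  then have "summable (\<lambda>j::nat. measure M A)"
    by (simp add: measure_def eq sums_iff)
  then have "measure M A = 0"
    by (simp add: summable_const_iff)
  with nz show False
    by (simp add: emeasure_eq_measure)
qed

text \<open>The bound is non-strict to make the set closed, and below 1 so that \<open>x t\<close>
  and \<open>- x t\<close> cannot both satisfy it.\<close>

definition near_one_characters :: "real \<Rightarrow> (real \<Rightarrow> complex) set" where
  "near_one_characters r = {x \<in> carrier bohr_group. \<forall>t. \<bar>t\<bar> < r \<longrightarrow> cmod (x t - 1) \<le> 1 / 2}"

lemma continuous_map_bohr_topology_eval: "continuous_map bohr_topology euclidean (\<lambda>x. x t)"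
  unfolding bohr_topology_def
  using continuous_map_product_projection[of t UNIV "\<lambda>k. top_of_set (carrier circle_group)"]
  by (intro continuous_map_from_subtopology) (simp add: continuous_map_in_subtopology)

text \<open>Measurability goes through closedness because the set is cut out by uncountably many
  conditions, one for each \<open>t\<close>.\<close>

lemma closedin_near_one_characters:
  assumes "r > 0"
  shows "closedin bohr_topology (near_one_characters r)"
proof -
  have "closedin bohr_topology
          (topspace bohr_topology
            \<inter> (\<Inter>t\<in>{t. \<bar>t\<bar> < r}. {x \<in> topspace bohr_topology. x t \<in> cball 1 (1 / 2)}))"
    \<comment> \<open>Since \<open>r > 0\<close>, the index set contains 0;
      \<open>closedin_INT\<close> needs it nonempty.\<close>
    using assms
    by (intro closedin_Int closedin_topspace closedin_INT
        closedin_continuous_map_preimage[OF continuous_map_bohr_topology_eval])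
      (auto intro: exI[of _ 0])
  also have "\<dots> = near_one_characters r"
    by (auto simp: near_one_characters_def topspace_bohr_topology dist_norm norm_minus_commute)
  finally show ?thesis .
qed

lemma cis_in_bohr_group: "(\<lambda>t. cis (c * t)) \<in> carrier bohr_group"
  by (simp add: carrier_bohr_group cis_mult distrib_left)

lemma disjoint_translates_near_one_characters:
  assumes "pi < r * \<bar>c - d\<bar>"
  shows "(\<lambda>x. (\<lambda>t. cis (c * t)) \<otimes>\<^bsub>bohr_group\<^esub> x) ` near_one_characters r
       \<inter> (\<lambda>x. (\<lambda>t. cis (d * t)) \<otimes>\<^bsub>bohr_group\<^esub> x) ` near_one_characters r = {}"
proof (rule ccontr)
  assume "\<not> ?thesis"
  then obtain a b where a: "a \<in> near_one_characters r" and b: "b \<in> near_one_characters r"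
    and "(\<lambda>t. cis (c * t)) \<otimes>\<^bsub>bohr_group\<^esub> a = (\<lambda>t. cis (d * t)) \<otimes>\<^bsub>bohr_group\<^esub> b"
    by auto
  then have eq: "cis (c * t) * a t = cis (d * t) * b t" for t
    by (auto simp: bohr_group_def circle_group_def dest: fun_cong)
  \<comment> \<open>At this point the two translating characters differ by the factor
    \<open>cis pi = -1\<close>; the assumption on \<open>r\<close> places it inside the
    interval.\<close>
  define t where "t = pi / (c - d)"
  have cd: "c \<noteq> d"
    using assms pi_gt_zero by (auto simp del: pi_gt_zero)
  then have "\<bar>t\<bar> < r"
    using assms by (simp add: t_def abs_divide divide_simps)
  then have "cmod (a t - 1) \<le> 1 / 2" "cmod (b t - 1) \<le> 1 / 2"
    using a b by (auto simp: near_one_characters_def)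
  moreover have "c * t = d * t + pi"
    using cd by (simp add: t_def field_simps)
  then have "cis (d * t) * b t = cis (d * t) * (- a t)"
    using eq[of t] by (simp flip: cis_mult)
  then have "b t = - a t"
    by (simp only: mult_left_cancel[OF cis_neq_zero])
  \<comment> \<open>The two differences add up to -2, whereas the bounds on \<open>a t\<close> and
    \<open>b t\<close> allow a total of at most 1.\<close>
  moreover have "cmod 2 \<le> cmod (a t - 1) + cmod (- a t - 1)"
    using norm_triangle_ineq[of "a t - 1" "- a t - 1"] by simp
  ultimately show False
    by simp
qed

lemma near_one_characters_null:
  assumes Haar: "normalized_Haar_measure bohr_group bohr_topology M" and r: "r > 0"
  shows "near_one_characters r \<in> null_sets M"
proof -
  define A where "A = near_one_characters r"
  \<comment> \<open>Distinct frequencies are at least \<open>4 / r\<close> apart, and 4 exceeds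
    \<open>pi\<close>, as the disjointness lemma demands.\<close>
  define c :: "nat \<Rightarrow> real" where "c j = 4 / r * real j" for j
  define B where "B j = (\<lambda>x. (\<lambda>t. cis (c j * t)) \<otimes>\<^bsub>bohr_group\<^esub> x) ` A" for j
  have sets: "sets M = sigma_sets (topspace bohr_topology) {U. openin bohr_topology U}"
    and space: "space M = topspace bohr_topology" and total: "emeasure M (space M) = 1"
    and inv: "\<And>g S. g \<in> carrier bohr_group \<Longrightarrow> S \<in> sets M
      \<Longrightarrow> emeasure M ((\<lambda>x. g \<otimes>\<^bsub>bohr_group\<^esub> x) ` S) = emeasure M S"
    using Haar unfolding normalized_Haar_measure_def by blast+
  interpret finite_measure M
    by (rule finite_measureI) (simp add: total)
  have "openin bohr_topology (space M - A)" and sub: "A \<subseteq> space M"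
    using closedin_near_one_characters[OF r] by (auto simp: A_def closedin_def space)
  then have "space M - A \<in> sets M"
    by (simp add: sets)
  then have A: "A \<in> sets M"
    using sets.compl_sets[of "space M - A" M] sub by (simp only: double_diff[OF _ order_refl])
  have "emeasure M (B j) = emeasure M A" for j
    unfolding B_def using cis_in_bohr_group A by (rule inv)
  moreover have "disjoint_family B"
  proof (unfold disjoint_family_on_def, intro ballI impI)
    fix i j :: nat
    assume "i \<noteq> j"
    then have "1 \<le> \<bar>real i - real j\<bar>"
      by linarith
    then have "pi < 4 * \<bar>real i - real j\<bar>"
      using less_le_trans[OF pi_less_4] by simp
    moreover have "c i - c j = 4 / r * (real i - real j)"
      by (simp only: c_def right_diff_distrib)
    then have "r * \<bar>c i - c j\<bar> = 4 * \<bar>real i - real j\<bar>"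
      using r by (simp only: abs_mult abs_divide) simp
    ultimately have "pi < r * \<bar>c i - c j\<bar>"
      by (simp only:)
    then show "B i \<inter> B j = {}"
      unfolding B_def A_def by (rule disjoint_translates_near_one_characters)
  qed
  ultimately show ?thesis
    using null_sets_disjoint_family A unfolding A_def by blast
qed

text \<open>Continuity moves from \<open>s\<close> to 0 because
  \<open>x (s + t) - x s = x s * (x t - 1)\<close> and \<open>x s\<close> has modulus 1.\<close>

lemma isCont_imp_near_one:
  assumes x: "x \<in> carrier bohr_group" and "isCont x s"
  shows "\<exists>n. x \<in> near_one_characters (1 / real (Suc n))"
proof -
  obtain d where "d > 0" and d: "\<And>u. dist u s < d \<Longrightarrow> dist (x u) (x s) < 1 / 2"
    using assms(2) unfolding continuous_at_eps_delta dist_norm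
    by (metis half_gt_zero_iff zero_less_one)
  obtain n where n: "1 / real (Suc n) < d"
    using nat_approx_posE[OF \<open>d > 0\<close>] by auto
  have "cmod (x t - 1) \<le> 1 / 2" if "\<bar>t\<bar> < 1 / real (Suc n)" for t
  proof -
    have "cmod (x (s + t) - x s) < 1 / 2"
      using d[of "s + t"] that n by (simp add: dist_norm)
    moreover have "x (s + t) - x s = x s * (x t - 1)" "cmod (x s) = 1"
      using x by (auto simp: carrier_bohr_group right_diff_distrib)
    ultimately show ?thesis
      by (simp add: norm_mult)
  qed
  then show ?thesis
    using x by (auto simp: near_one_characters_def)
qed

theorem proposition1:
  fixes \<mu>\<^sub>0 :: "(real \<Rightarrow> complex) measure"
  assumes "normalized_Haar_measure bohr_group bohr_topology \<mu>\<^sub>0"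
  shows "carrier bohr_group - everywhere_discontinuous_characters =
           {x \<in> carrier bohr_group. \<exists>s\<^sub>0. isCont x s\<^sub>0}
         \<and> (\<exists>N \<in> null_sets \<mu>\<^sub>0. carrier bohr_group - everywhere_discontinuous_characters \<subseteq> N)"
proof
  show eq: "carrier bohr_group - everywhere_discontinuous_characters =
           {x \<in> carrier bohr_group. \<exists>s\<^sub>0. isCont x s\<^sub>0}"
    by (auto simp: everywhere_discontinuous_characters_def)
  \<comment> \<open>Restricting to the radii \<open>1 / real (Suc n)\<close> keeps the union
    countable, hence null.\<close>
  have "(\<Union>n. near_one_characters (1 / real (Suc n))) \<in> null_sets \<mu>\<^sub>0"
    by (intro null_sets_UN near_one_characters_null[OF assms]) simp
  moreover have "carrier bohr_group - everywhere_discontinuous_characters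
      \<subseteq> (\<Union>n. near_one_characters (1 / real (Suc n)))"
    unfolding eq using isCont_imp_near_one by fast
  ultimately show "\<exists>N \<in> null_sets \<mu>\<^sub>0. carrier bohr_group - everywhere_discontinuous_characters \<subseteq> N"
    by (rule bexI[rotated])
qed

end
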